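(* $$\prod_{n=1}^{\infty}\begin{pmatrix}\frac{n}{2(2n+1)} & \frac{3}{2n}\\ 0 & 1\end{pmatrix}=\begin{pmatrix}0 & \zeta(2)\\ 0 & 1\end{pmatrix}.$$
   Context: $\zeta(s)=\sum_{n\geqslant1}n^{-s}$ is the Riemann zeta function. The infinite product $\prod_{n=1}^\infty \mathbf{M}_n$ of square matrices means the entrywise limit as $m\to\infty$ of the ordered products $\mathbf{M}_1\mathbf{M}_2\cdots\mathbf{M}_m$ (factors multiplied from left to right in increasing index). *)

theory Defs
  imports "HOL-Analysis.Analysis"
begin

text \<open>
  The Riemann zeta function given by its Dirichlet series. The value is meaningful only for
  \<open>Re s > 1\<close>, where the series converges; no analytic continuation is involved.
  The summation index is shifted, since \<open>suminf\<close> starts at \<open>0\<close>.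
\<close>
definition zeta :: "complex \<Rightarrow> complex" where
  "zeta s = (\<Sum>n. of_nat (Suc n) powr (- s))"

text \<open>\<open>partial_mat_prod M m = M 1 ** M 2 ** \<dots> ** M m\<close>; the value \<open>M 0\<close> is ignored.\<close>
primrec partial_mat_prod ::
    "(nat \<Rightarrow> 'a::semiring_1 ^ 'n ^ 'n) \<Rightarrow> nat \<Rightarrow> 'a ^ 'n ^ 'n" where
  "partial_mat_prod M 0 = mat 1"
| "partial_mat_prod M (Suc m) = partial_mat_prod M m ** M (Suc m)"

definition has_mat_prod ::
    "(nat \<Rightarrow> 'a::{semiring_1, topological_space} ^ 'n ^ 'n) \<Rightarrow> 'a ^ 'n ^ 'n \<Rightarrow> bool"
    (infixr "has'_mat'_prod" 80) where
  "M has_mat_prod L \<longleftrightarrow>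
     (\<forall>i j. (\<lambda>m. partial_mat_prod M m $ i $ j) \<longlonglongrightarrow> L $ i $ j)"

end

theory Submission imports Defs begin

text \<open>
  The upper left entry of the \<open>m\<close>-th partial product is \<open>m!\<^sup>2 / (2m+1)!\<close>, so the upper right
  entry is the partial sum of \<open>3 \<Sum> n!\<^sup>2 / (2n+2)!\<close>. That this series equals \<open>\<zeta>(2)\<close> follows
  from the WZ pair
  \<open>F(n,k) = n! k! / ((k+1) (n+k+1)!)\<close>, \<open>G(n,k) = n! k! / ((n+1) (n+k+1)!)\<close>, which satisfies
  \<open>F(n,k) - F(n+1,k) = G(n,k) - G(n,k+1)\<close>: the tails \<open>A(n) = \<Sum>k\<ge>n. F(n,k)\<close> start at
  \<open>A(0) = \<zeta>(2)\<close>, tend to \<open>0\<close>, and decrease by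
  \<open>F(n,n) + G(n,n+1) = 3 n!\<^sup>2 / (2n+2)!\<close>.
\<close>

definition wzF :: "nat \<Rightarrow> nat \<Rightarrow> real" where
  "wzF n k = fact n * fact k / ((real k + 1) * fact (n + k + 1))"

definition wzG :: "nat \<Rightarrow> nat \<Rightarrow> real" where
  "wzG n k = fact n * fact k / ((real n + 1) * fact (n + k + 1))"

text \<open>Both differences equal \<open>n! k! / (n+k+2)!\<close>. In the scalar identity
  \<open>*\<close>, take u = k+1, v = n+1 and d = (n+k+1)!. Its right-hand side is symmetric in u
  and v, so exchanging them turns the computation for \<open>wzF\<close> into the one for
  \<open>wzG\<close>.\<close>

lemma wz_pair: "wzF n k - wzF (Suc n) k = wzG n k - wzG n (Suc k)"
proof -
  have *: "c / (u * d) - v * c / (u * ((v + u) * d)) = c / ((v + u) * d)"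
    if "u > 0" "v > 0" "d > 0" for c d u v :: real
  proof -
    have "c / (u * d) = (v + u) * c / (u * ((v + u) * d))"
      using that by simp
    then have "c / (u * d) - v * c / (u * ((v + u) * d)) = u * c / (u * ((v + u) * d))"
      by (simp add: diff_divide_distrib[symmetric] distrib_right)
    then show ?thesis using that by simp
  qed
  define d :: real where "d = fact (n + k + 1)"
  have d: "d > 0" by (simp add: d_def del: fact_Suc)
  have f: "fact (Suc (n + k + 1)) = (real n + 1 + (real k + 1)) * d"
    unfolding d_def by (subst fact_Suc) (simp del: fact_Suc)
  have "wzF n k - wzF (Suc n) k = fact n * fact k / ((real n + 1 + (real k + 1)) * d)"
    using *[of "real k + 1" "real n + 1" d "fact n * fact k"] d f
    by (simp add: wzF_def d_def[symmetric] mult_ac add_ac)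
  moreover have "wzG n k - wzG n (Suc k) = fact n * fact k / ((real k + 1 + (real n + 1)) * d)"
    using *[of "real n + 1" "real k + 1" d "fact n * fact k"] d f
    by (simp add: wzG_def d_def[symmetric] mult_ac add_ac)
  ultimately show ?thesis by (simp add: add_ac)
qed

lemma wzF_nonneg: "0 \<le> wzF n k"
  by (simp add: wzF_def)

lemma wzF_0: "wzF 0 k = 1 / (real k + 1)\<^sup>2"
  by (simp add: wzF_def power2_eq_square add_ac)

text \<open>n! (k+1)! divides (n+k+1)!, the quotient being a binomial coefficient. The bound is
  \<open>wzF 0 k\<close>, hence uniform in n; it yields summability, the vanishing of the tails and
  the decay of the diagonal entry.\<close>

lemma wzF_le: "wzF n k \<le> 1 / (real k + 1)\<^sup>2"
proof -
  have "fact n * fact (Suc k) dvd (fact (n + Suc k) :: nat)"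
    by (rule fact_fact_dvd_fact)
  then have "fact n * fact (Suc k) \<le> (fact (n + Suc k) :: nat)"
    by (rule dvd_imp_le) simp
  then have "real (fact n * fact (Suc k)) \<le> real (fact (n + Suc k))"
    by (rule of_nat_mono)
  then have "fact n * ((real k + 1) * fact k) \<le> fact (n + k + 1)"
    by (simp add: algebra_simps)
  then have "fact n * fact k / fact (n + k + 1) \<le> 1 / (real k + 1)"
    by (simp add: divide_simps mult_ac del: fact_Suc)
  then have "fact n * fact k / fact (n + k + 1) / (real k + 1) \<le> 1 / (real k + 1) / (real k + 1)"
    by (rule divide_right_mono) simp
  then show ?thesis
    by (simp add: wzF_def power2_eq_square mult_ac del: fact_Suc)
qed

lemma summable_inverse_squares: "summable (\<lambda>k. 1 / (real k + 1)\<^sup>2)"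
  using inverse_squares_sums by (simp add: sums_iff add_ac)

lemma summable_wzF: "summable (\<lambda>k. wzF n (k + m))"
proof -
  have "summable (wzF n)"
    by (rule summable_comparison_test'[OF summable_inverse_squares, of 0])
      (simp add: wzF_nonneg wzF_le)
  then show ?thesis by (rule summable_ignore_initial_segment)
qed

lemma wzG_tendsto_0: "wzG n \<longlonglongrightarrow> 0"
proof (rule tendsto_sandwich)
  show "\<forall>\<^sub>F k in sequentially. 0 \<le> wzG n k"
    by (simp add: wzG_def)
  show "\<forall>\<^sub>F k in sequentially. wzG n k \<le> 1 / (real k + 1)"
  proof (intro always_eventually allI)
    fix k
    \<comment> \<open>Passing from \<open>wzF\<close> to \<open>wzG\<close> costs a factor of at
      most k+1, and the quadratic decay of \<open>wzF\<close> in k absorbs it.\<close>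
    have "wzG n k = (real k + 1) / (real n + 1) * wzF n k"
      by (simp add: wzG_def wzF_def del: fact_Suc)
    also have "\<dots> \<le> (real k + 1) * wzF n k"
      by (intro mult_right_mono wzF_nonneg) (simp add: divide_simps)
    also have "\<dots> \<le> (real k + 1) * (1 / (real k + 1)\<^sup>2)"
      by (intro mult_left_mono wzF_le) simp
    also have "\<dots> = 1 / (real k + 1)"
      by (simp add: power2_eq_square)
    finally show "wzG n k \<le> 1 / (real k + 1)" .
  qed
  show "(\<lambda>k. 1 / (real k + 1)) \<longlonglongrightarrow> 0"
    using LIMSEQ_inverse_real_of_nat by (simp add: inverse_eq_divide add_ac)
qed simp

definition wz_tail :: "nat \<Rightarrow> real" where
  "wz_tail n = (\<Sum>k. wzF n (k + n))"

lemma wz_tail_diff: "wz_tail n - wz_tail (Suc n) = 3 * (fact n)\<^sup>2 / fact (2 * n + 2)"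
proof -
  \<comment> \<open>Only \<open>wz_tail n\<close> contains a term with second index n. Once it is
    split off, both sums run over indices from n+1 on and can be subtracted termwise.\<close>
  have "wz_tail n = (\<Sum>k. wzF n (k + Suc n)) + wzF n n"
    unfolding wz_tail_def using suminf_split_head[OF summable_wzF[of n n]] by simp
  moreover have "(\<Sum>k. wzF n (k + Suc n)) - wz_tail (Suc n)
      = (\<Sum>k. wzF n (k + Suc n) - wzF (Suc n) (k + Suc n))"
    unfolding wz_tail_def by (rule suminf_diff[OF summable_wzF summable_wzF])
  \<comment> \<open>By \<open>wz_pair\<close> the termwise differences telescope in k, leaving only
    the boundary value at k = n+1.\<close>
  moreover have "(\<lambda>k. wzG n (k + Suc n) - wzG n (Suc k + Suc n)) sums (wzG n (0 + Suc n) - 0)"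
    by (rule telescope_sums'[where f = "\<lambda>k. wzG n (k + Suc n)"])
      (rule LIMSEQ_ignore_initial_segment[OF wzG_tendsto_0])
  then have "(\<Sum>k. wzF n (k + Suc n) - wzF (Suc n) (k + Suc n)) = wzG n (Suc n)"
    by (simp add: wz_pair sums_iff)
  ultimately have "wz_tail n - wz_tail (Suc n) = wzF n n + wzG n (Suc n)"
    by linarith
  \<comment> \<open>The coefficient 3 is 2 + 1: two copies come from the split-off head, as (2n+2)!
    = 2 (n+1) (2n+1)!, and one from the telescoped boundary value.\<close>
  moreover have "wzF n n = 2 * (fact n)\<^sup>2 / fact (2 * n + 2)"
  proof -
    have "fact (2 * n + 2) = 2 * ((real n + 1) * fact (2 * n + 1))"
      by (simp add: algebra_simps)
    moreover have "n + n + 1 = 2 * n + 1" by simp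
    ultimately show ?thesis
      unfolding wzF_def by (simp only: power2_eq_square mult_divide_mult_cancel_left_if) simp
  qed
  moreover have "wzG n (Suc n) = (fact n)\<^sup>2 / fact (2 * n + 2)"
  proof -
    have "fact (Suc n) = (real n + 1) * fact n"
      by (simp add: algebra_simps)
    then have "fact n * fact (Suc n) = (real n + 1) * (fact n)\<^sup>2"
      by (simp only: power2_eq_square mult_ac)
    moreover have "n + Suc n + 1 = 2 * n + 2" by simp
    ultimately show ?thesis
      unfolding wzG_def by (simp only: mult_divide_mult_cancel_left_if) simp
  qed
  ultimately show ?thesis by (simp only: add_divide_distrib[symmetric]) simp
qed

lemma wz_tail_tendsto_0: "wz_tail \<longlonglongrightarrow> 0"
proof (rule tendsto_sandwich)
  show "\<forall>\<^sub>F n in sequentially. 0 \<le> wz_tail n"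
    unfolding wz_tail_def
    by (intro always_eventually allI suminf_nonneg summable_wzF wzF_nonneg)
  \<comment> \<open>Domination by \<open>wzF 0\<close> replaces a sum whose terms vary with n by the
    tail of one fixed convergent series.\<close>
  show "\<forall>\<^sub>F n in sequentially. wz_tail n \<le> (\<Sum>k. wzF 0 (k + n))"
    unfolding wz_tail_def
    by (intro always_eventually allI suminf_le summable_wzF) (simp only: wzF_0 wzF_le)
  show "(\<lambda>n. \<Sum>k. wzF 0 (k + n)) \<longlonglongrightarrow> 0"
    using suminf_exist_split2[of "wzF 0"] summable_wzF[of 0 0] by simp
qed simp

lemma inverse_central_binomial_sums:
  "(\<lambda>n. 3 * (fact n)\<^sup>2 / fact (2 * n + 2)) sums (\<Sum>k. 1 / (real k + 1)\<^sup>2)"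
proof -
  have "(\<lambda>n. wz_tail n - wz_tail (Suc n)) sums (wz_tail 0 - 0)"
    by (rule telescope_sums'[OF wz_tail_tendsto_0])
  then show ?thesis
    unfolding wz_tail_diff by (simp add: wz_tail_def wzF_0 del: fact_Suc)
qed

lemma zeta_2: "zeta 2 = of_real (\<Sum>k. 1 / (real k + 1)\<^sup>2)"
proof -
  have "of_nat (Suc k) powr (- 2) = complex_of_real (1 / (real k + 1)\<^sup>2)" for k
  proof -
    have "of_nat (Suc k) powr (- 2 :: complex) = inverse (of_nat (Suc k) powr 2)"
      by (rule powr_minus)
    also have "\<dots> = inverse (of_nat (Suc k) ^ 2)"
      using powr_nat'[of "of_nat (Suc k) :: complex" 2] by (simp del: of_nat_Suc)
    finally show ?thesis
      by (simp add: inverse_eq_divide add_ac)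
  qed
  then show ?thesis
    by (simp only: zeta_def suminf_of_real[OF summable_inverse_squares])
qed

lemma square_fact_tendsto_0: "(\<lambda>m. (fact m)\<^sup>2 / fact (2 * m + 1) :: real) \<longlonglongrightarrow> 0"
proof (rule tendsto_sandwich)
  show "\<forall>\<^sub>F m in sequentially. 0 \<le> ((fact m)\<^sup>2 / fact (2 * m + 1) :: real)"
    by (intro always_eventually allI divide_nonneg_nonneg) (simp_all del: fact_Suc)
  show "\<forall>\<^sub>F m in sequentially. (fact m)\<^sup>2 / fact (2 * m + 1) \<le> 1 / (real m + 1)"
  proof (intro always_eventually allI)
    fix m
    \<comment> \<open>The entry is a rescaled diagonal value of \<open>wzF\<close>, so the bound
      \<open>wzF_le\<close> serves here too.\<close>
    have "(fact m)\<^sup>2 / fact (2 * m + 1) = (real m + 1) * wzF m m"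
      by (simp add: wzF_def power2_eq_square mult_2 del: fact_Suc)
    also have "\<dots> \<le> (real m + 1) * (1 / (real m + 1)\<^sup>2)"
      by (intro mult_left_mono wzF_le) simp
    also have "\<dots> = 1 / (real m + 1)"
      by (simp add: power2_eq_square)
    finally show "(fact m)\<^sup>2 / fact (2 * m + 1) \<le> 1 / (real m + 1)" .
  qed
  show "(\<lambda>m. 1 / (real m + 1)) \<longlonglongrightarrow> 0"
    using LIMSEQ_inverse_real_of_nat by (simp add: inverse_eq_divide add_ac)
qed simp

lemma matrix_mult_2x2_upper_triangular:
  fixes a b c d :: "'a::semiring_1"
  shows "vector [vector [a, b], vector [0, 1]] ** (vector [vector [c, d], vector [0, 1]] :: 'a^2^2)
    = (vector [vector [a * c, a * d + b], vector [0, 1]] :: 'a^2^2)"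
  unfolding vec_eq_iff forall_2 by (simp add: matrix_matrix_mult_def sum_2)

lemma partial_mat_prod_eq:
  "partial_mat_prod
     (\<lambda>n. vector [vector [of_nat n / (2 * (2 * of_nat n + 1)), 3 / (2 * of_nat n)],
                  vector [0, 1]] :: complex ^ 2 ^ 2) m
   = vector [vector [of_real ((fact m)\<^sup>2 / fact (2 * m + 1)),
                     of_real (\<Sum>n<m. 3 * (fact n)\<^sup>2 / fact (2 * n + 2))],
             vector [0, 1]]"
proof (induction m)
  case 0
  show ?case by (simp add: vec_eq_iff forall_2 mat_def)
next
  case (Suc m)
  have f2: "fact (2 * m + 2) = (2 * real m + 2) * fact (2 * m + 1)"
    by (simp add: algebra_simps)
  have f3: "fact (2 * Suc m + 1) = (2 * real m + 3) * ((2 * real m + 2) * fact (2 * m + 1))"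
    by (simp add: algebra_simps)
  have f1: "fact (Suc m) = (real m + 1) * fact m"
    by (simp add: algebra_simps)
  have diag: "(fact m)\<^sup>2 / fact (2 * m + 1) * (real (Suc m) / (2 * (2 * real (Suc m) + 1)))
      = (fact (Suc m))\<^sup>2 / fact (2 * Suc m + 1)"
    unfolding f1 f3 by (simp add: divide_simps power2_eq_square del: fact_Suc)
      (simp add: algebra_simps del: fact_Suc)
  \<comment> \<open>The factor with index m+1 contributes the summand with index m: its upper right
    entry is multiplied by the upper left entry of the previous partial product.\<close>
  have upper: "(fact m)\<^sup>2 / fact (2 * m + 1) * (3 / (2 * real (Suc m)))
      = 3 * (fact m)\<^sup>2 / fact (2 * m + 2)"
    unfolding f2 by (simp add: divide_simps del: fact_Suc)
  \<comment> \<open>Writing the complex entries as images of reals makes the real identities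
    \<open>diag\<close> and \<open>upper\<close> applicable.\<close>
  have "of_nat (Suc m) / (2 * (2 * of_nat (Suc m) + 1))
      = complex_of_real (real (Suc m) / (2 * (2 * real (Suc m) + 1)))"
    "3 / (2 * of_nat (Suc m)) = complex_of_real (3 / (2 * real (Suc m)))"
    by simp_all
  then show ?case
    unfolding partial_mat_prod.simps Suc.IH matrix_mult_2x2_upper_triangular
    by (simp only: of_real_mult[symmetric] of_real_add[symmetric] diag upper sum.lessThan_Suc
        add.commute[of _ "sum _ _"])
qed

theorem theorem6p1:
  "(\<lambda>n. vector [vector [of_nat n / (2 * (2 * of_nat n + 1)), 3 / (2 * of_nat n)],
                vector [0, 1]] :: complex ^ 2 ^ 2)
   has_mat_prod
   vector [vector [0, zeta 2],
           vector [0, 1]]"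
proof -
  have "(\<lambda>m. complex_of_real ((fact m)\<^sup>2 / fact (2 * m + 1))) \<longlonglongrightarrow> of_real 0"
    by (rule tendsto_of_real[OF square_fact_tendsto_0])
  moreover have "(\<lambda>m. complex_of_real (\<Sum>n<m. 3 * (fact n)\<^sup>2 / fact (2 * n + 2))) \<longlonglongrightarrow> zeta 2"
    unfolding zeta_2 using inverse_central_binomial_sums
    by (intro tendsto_of_real) (simp only: sums_def)
  ultimately show ?thesis
    unfolding has_mat_prod_def partial_mat_prod_eq by (simp only: forall_2 vector_2 of_real_0) simp
qed

end
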